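(* Let $\mathbb P,\mathbb X,\mathbb Y$ be real Banach spaces, let $C$ be a closed convex cone with $\{\mathbf 0\}\subsetneqq C\subsetneqq\mathbb Y$, let $\varphi:\mathbb P\times\mathbb X\to\mathbb R$, and let $F:\mathbb P\times\mathbb X\rightrightarrows\mathbb Y$ be a set-valued mapping with nonempty closed values. For $p\in\mathbb P$ let $(\mathsf P_p)$ be the problem of minimizing $\varphi(p,x)$ over $x\in\mathbb X$ subject to $F(p,x)\subseteq C$, and put $\mathsf R(p)=\{x\in\mathbb X\mid F(p,x)\subseteq C\}$, $\mathsf{val}(p)=\inf_{x\in\mathsf R(p)}\varphi(p,x)$, $\mathsf{Argmin}(p)=\{x\in\mathsf R(p)\mid\varphi(p,x)=\mathsf{val}(p)\}$. Suppose that the family $(\mathsf P_p)_{p\in\mathbb P}$ is q.c.s.v.i. (defined in the context), with $\mathrm{dom}\,\mathsf{val}=\mathbb P$. Then for any $\bar p\in\mathrm{dom}\,\mathsf{val}=\mathbb P$, problem $(\mathsf P_{\bar p})$ is calm at any $\bar x\in\mathsf{Argmin}(\bar p)$.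
   Context: Conventions: $\inf\varnothing=+\infty$; $\mathrm{dom}\,\mathsf{val}$ is the set of points where $\mathsf{val}$ is finite. $\mathrm{dist}(y;S)=\inf_{s\in S}\|y-s\|$. For a nonempty set $S$ and $r\ge0$, $\mathrm B[S;r]=\{y\mid\mathrm{dist}(y;S)\le r\}$; for a point $x$, $\mathrm B[x;r]$ is the closed ball. Problem calmness: for $\bar p\in\mathbb P$ and $\bar x\in\mathsf{Argmin}(\bar p)$, problem $(\mathsf P_{\bar p})$ is calm at $\bar x$ if there exist $r,\lambda>0$ such that $$\inf_{p\in\mathrm B[\bar p;r]\setminus\{\bar p\}}\ \inf_{x\in\mathrm B[\bar x;r]\cap\mathsf R(p)}\frac{\varphi(p,x)-\varphi(\bar p,\bar x)}{\|p-\bar p\|}\ge-\lambda.$$ q.c.s.v.i. (qualified convex with set-valued inclusion constraints) family: the family given by $(\varphi,F,C)$ is q.c.s.v.i. if (i) $\varphi$ is convex and continuous on $\mathbb P\times\mathbb X$; (ii) for every $p\in\mathbb P$ there is $\hat x_p\in\mathbb X$ such that $F(p,\hat x_p)$ is $C$-bounded, i.e. $F(p,\hat x_p)\setminus C$ is norm-bounded; (iii) for every $p$, $F(p,\cdot)$ is lower semicontinuous on $\mathbb X$; (iv) $F$ is $C$-concave: $F(t(p_1,x_1)+(1-t)(p_2,x_2))\subseteq tF(p_1,x_1)+(1-t)F(p_2,x_2)+C$ for all $(p_i,x_i)\in\mathbb P\times\mathbb X$, $t\in[0,1]$; (v) for every $x$, $F(\cdot,x)$ is Hausdorff $C$-upper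 semicontinuous on $\mathbb P$: for every $p_0\in\mathbb P$ and $\varepsilon>0$ there is $\delta>0$ with $F(p,x)\subseteq\mathrm B[F(p_0,x)+C;\varepsilon]$ for all $p\in\mathrm B[p_0;\delta]$; (vi) $\alpha_F>1$, where $\alpha_F=\inf\{\mathrm{inc}(F(p,\cdot);x)\mid(p,x)\in\mathbb P\times\mathbb X,\ F(p,x)\not\subseteq C\}$. Here, for $G:\mathbb X\rightrightarrows\mathbb Y$ and $x_0\in\mathbb X$, $\mathrm{inc}(G;x_0)$ is the supremum of all $\alpha>1$ for which there is $\delta>0$ such that for all $r\in(0,\delta]$ there exists $u\in\mathrm B[x_0;r]$ with $\mathrm B[G(u);\alpha r]\subseteq\mathrm B[G(x_0)+C;r]$ (with $\sup\varnothing=-\infty$). *)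

theory Defs
  imports "HOL-Analysis.Analysis" "HOL-Library.Set_Algebras" "HOL-Library.Extended_Real"
begin

text \<open>
  A parametric problem is given by an objective \<open>\<phi> : P \<times> X \<rightarrow> \<real>\<close>, a set-valued map
  \<open>F : P \<times> X \<rightarrow> 2\<^sup>Y\<close> and a cone \<open>C\<close> in \<open>Y\<close>. Infima and suprema are taken in \<^typ>\<open>ereal\<close>, so that
  the infimum over the empty set is \<open>\<infinity>\<close> and the supremum over it is \<open>-\<infinity>\<close>. The sum \<open>A + B\<close> of
  two sets is the Minkowski sum.
\<close>

subsection \<open>The problems\<close>

definition feasible :: "('p \<times> 'x \<Rightarrow> 'y set) \<Rightarrow> 'y set \<Rightarrow> 'p \<Rightarrow> 'x set" where
  "feasible F C p = {x. F (p, x) \<subseteq> C}"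

definition val :: "('p \<times> 'x \<Rightarrow> real) \<Rightarrow> ('p \<times> 'x \<Rightarrow> 'y set) \<Rightarrow> 'y set \<Rightarrow> 'p \<Rightarrow> ereal" where
  "val \<phi> F C p = (INF x \<in> feasible F C p. ereal (\<phi> (p, x)))"

definition dom_val :: "('p \<times> 'x \<Rightarrow> real) \<Rightarrow> ('p \<times> 'x \<Rightarrow> 'y set) \<Rightarrow> 'y set \<Rightarrow> 'p set" where
  "dom_val \<phi> F C = {p. \<bar>val \<phi> F C p\<bar> \<noteq> \<infinity>}"

definition Argmin :: "('p \<times> 'x \<Rightarrow> real) \<Rightarrow> ('p \<times> 'x \<Rightarrow> 'y set) \<Rightarrow> 'y set \<Rightarrow> 'p \<Rightarrow> 'x set" where
  "Argmin \<phi> F C p = {x \<in> feasible F C p. ereal (\<phi> (p, x)) = val \<phi> F C p}"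

definition calm_problem ::
  "('p::real_normed_vector \<times> 'x::real_normed_vector \<Rightarrow> real) \<Rightarrow> ('p \<times> 'x \<Rightarrow> 'y set) \<Rightarrow> 'y set
    \<Rightarrow> 'p \<Rightarrow> 'x \<Rightarrow> bool" where
  "calm_problem \<phi> F C pbar xbar \<longleftrightarrow>
     (\<exists>r>0. \<exists>l>0.
        (INF p \<in> cball pbar r - {pbar}. INF x \<in> cball xbar r \<inter> feasible F C p.
           ereal ((\<phi> (p, x) - \<phi> (pbar, xbar)) / norm (p - pbar))) \<ge> ereal (- l))"

subsection \<open>Set-valued maps\<close>

text \<open>
  The closed \<open>r\<close>-enlargement \<open>B[S; r]\<close>. The guard is needed because \<^const>\<open>infdist\<close> is \<open>0\<close>, not
  \<open>\<infinity>\<close>, for the empty set.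
\<close>

definition enlargement :: "'y::real_normed_vector set \<Rightarrow> real \<Rightarrow> 'y set" where
  "enlargement S r = {y. S \<noteq> {} \<and> infdist y S \<le> r}"

definition cone_bounded :: "'y::real_normed_vector set \<Rightarrow> 'y set \<Rightarrow> bool" where
  "cone_bounded C S \<longleftrightarrow> bounded (S - C)"

definition lsc_map :: "('x::topological_space \<Rightarrow> 'y::topological_space set) \<Rightarrow> bool" where
  "lsc_map G \<longleftrightarrow>
     (\<forall>x0 U. open U \<and> G x0 \<inter> U \<noteq> {} \<longrightarrow> (\<forall>\<^sub>F x in nhds x0. G x \<inter> U \<noteq> {}))"

definition cone_concave ::
  "'y::real_vector set \<Rightarrow> ('z::real_vector \<Rightarrow> 'y set) \<Rightarrow> bool" where
  "cone_concave C F \<longleftrightarrow>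
     (\<forall>z1 z2. \<forall>t\<in>{0..1::real}.
        F (t *\<^sub>R z1 + (1 - t) *\<^sub>R z2) \<subseteq> (*\<^sub>R) t ` F z1 + (*\<^sub>R) (1 - t) ` F z2 + C)"

definition Hausdorff_cone_usc ::
  "'y::real_normed_vector set \<Rightarrow> ('p::real_normed_vector \<Rightarrow> 'y set) \<Rightarrow> bool" where
  "Hausdorff_cone_usc C G \<longleftrightarrow>
     (\<forall>p0. \<forall>\<epsilon>>0. \<exists>\<delta>>0. \<forall>p\<in>cball p0 \<delta>. G p \<subseteq> enlargement (G p0 + C) \<epsilon>)"

text \<open>The exact bound \<open>inc(G; x0)\<close> of metric \<open>C\<close>-increase.\<close>

definition inc_bound ::
  "'y::real_normed_vector set \<Rightarrow> ('x::real_normed_vector \<Rightarrow> 'y set) \<Rightarrow> 'x \<Rightarrow> ereal" where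
  "inc_bound C G x0 =
     Sup (ereal ` {\<alpha>. \<alpha> > 1 \<and>
       (\<exists>\<delta>>0. \<forall>r\<in>{0<..\<delta>}. \<exists>u\<in>cball x0 r.
          enlargement (G u) (\<alpha> * r) \<subseteq> enlargement (G x0 + C) r)})"

definition alpha_inc ::
  "'y::real_normed_vector set \<Rightarrow> ('p \<times> 'x::real_normed_vector \<Rightarrow> 'y set) \<Rightarrow> ereal" where
  "alpha_inc C F = Inf {inc_bound C (\<lambda>u. F (p, u)) x | p x. \<not> F (p, x) \<subseteq> C}"

subsection \<open>Qualified convex families with set-valued inclusion constraints\<close>

definition qcsvi ::
  "('p::real_normed_vector \<times> 'x::real_normed_vector \<Rightarrow> real)
    \<Rightarrow> ('p \<times> 'x \<Rightarrow> 'y::real_normed_vector set) \<Rightarrow> 'y set \<Rightarrow> bool" where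
  "qcsvi \<phi> F C \<longleftrightarrow>
     convex_on UNIV \<phi> \<and> continuous_on UNIV \<phi> \<and>
     (\<forall>p. \<exists>x. cone_bounded C (F (p, x))) \<and>
     (\<forall>p. lsc_map (\<lambda>x. F (p, x))) \<and>
     cone_concave C F \<and>
     (\<forall>x. Hausdorff_cone_usc C (\<lambda>p. F (p, x))) \<and>
     alpha_inc C F > 1"

end

theory Submission
  imports Defs
begin

text \<open>
  Write \<open>v\<close> for the optimal value at \<open>pbar\<close>. Convexity of \<open>\<phi>\<close> and \<open>C\<close>-concavity of \<open>F\<close> make the
  value function convex, and a convex function that is bounded above by \<open>M\<close> on the ball of radius
  \<open>\<delta>\<close> about \<open>pbar\<close> cannot fall below \<open>v\<close> faster than linearly: a point \<open>p\<close> and the point at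
  distance \<open>\<delta>\<close> on the opposite side of \<open>pbar\<close> have \<open>pbar\<close> as a convex combination, so a steep
  drop at \<open>p\<close> would force the value at \<open>pbar\<close> below \<open>v\<close>. This is the content of
  \<open>locally_bounded_value_imp_calm\<close>, and it leaves a stability question: every parameter \<open>q\<close> near
  \<open>pbar\<close> must have a feasible point at which \<open>\<phi>\<close> is below a common bound. As \<open>\<phi>\<close> is continuous,
  it is enough to find the feasible point near \<open>xbar\<close>.

  The point \<open>xbar\<close> itself is almost feasible for such \<open>q\<close>, since Hausdorff upper semicontinuity
  puts \<open>F (q, xbar)\<close> within a small distance \<open>\<epsilon>\<close> of \<open>F (pbar, xbar) + C \<subseteq> C\<close>. The metric increase
  property turns this into a nearby feasible point. Measure infeasibility of \<open>x\<close> by the excess of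
  \<open>F (q, x)\<close> over \<open>C\<close>, the supremum of the distances to \<open>C\<close>. Outside a convex set the excess grows
  by at least \<open>\<rho>\<close> under enlargement by \<open>\<rho>\<close> (\<open>infdist_cball_growth\<close>), while adding \<open>C\<close> does not
  raise it (\<open>infdist_cone_le_infdist_plus\<close>). So if the \<open>\<alpha>r\<close>-enlargement of \<open>F (q, u)\<close> lies in
  the \<open>r\<close>-enlargement of \<open>F (q, x) + C\<close>, then moving from \<open>x\<close> to \<open>u\<close>, a step of length at most
  \<open>r\<close>, lowers the excess by at least \<open>(\<alpha> - 1) r\<close> or reaches feasibility. The excess is lower
  semicontinuous, and a Caristi-Ekeland argument in the complete space of the variable \<open>x\<close>
  (\<open>closed_descent_reaches_zero\<close>) concatenates such steps into a feasible point at distance at most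
  \<open>\<epsilon> / (\<alpha> - 1)\<close> from \<open>xbar\<close> (\<open>metric_increase_error_bound\<close>). The number \<open>\<alpha>\<close> does not depend on
  \<open>q\<close>, because \<open>\<alpha>\<close> can be any number strictly between \<open>1\<close> and the infimum defining \<open>alpha_inc\<close>.
\<close>

section \<open>Descent in complete metric spaces\<close>

lemma slope_bounded_Cauchy:
  fixes x :: "nat \<Rightarrow> 'a::metric_space" and s :: "nat \<Rightarrow> real"
  assumes step: "\<And>m n. m \<le> n \<Longrightarrow> dist (x m) (x n) \<le> s m - s n"
    and conv: "convergent s"
  shows "Cauchy x"
proof (rule metric_CauchyI)
  fix e :: real assume "e > 0"
  from conv have "Cauchy s" by (rule convergent_Cauchy)
  with \<open>e > 0\<close> obtain N where N: "\<And>m n. m \<ge> N \<Longrightarrow> n \<ge> N \<Longrightarrow> dist (s m) (s n) < e"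
    unfolding Cauchy_def by blast
  have "dist (x m) (x n) < e" if "m \<ge> N" "n \<ge> N" for m n
  proof (cases "m \<le> n")
    case True
    with step[of m n] N[OF that] show ?thesis by (simp add: dist_real_def)
  next
    case False
    with step[of n m] N[OF that] show ?thesis by (simp add: dist_real_def dist_commute)
  qed
  then show "\<exists>M. \<forall>m\<ge>M. \<forall>n\<ge>M. dist (x m) (x n) < e" by blast
qed

text \<open>
  The Caristi-Ekeland principle for a lower semicontinuous nonnegative function, given through a
  closed subset \<open>K\<close> of its epigraph, so that the function may take the value \<open>\<infinity>\<close>. From each point one moves to a point below it,
  in the order that trades distance for height, that realizes at least half of the drop still
  possible; the limit of this sequence is minimal for the order, so its height must be \<open>0\<close>.
\<close>

lemma closed_descent_reaches_zero:
  fixes K :: "('a::complete_space \<times> real) set"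
  assumes K: "closed K" and nonneg: "\<And>x s. (x, s) \<in> K \<Longrightarrow> 0 \<le> s"
    and descent: "\<And>x s. (x, s) \<in> K \<Longrightarrow> 0 < s
      \<Longrightarrow> \<exists>x' s'. (x', s') \<in> K \<and> s' < s \<and> dist x x' \<le> s - s'"
    and start: "(x0, s0) \<in> K"
  shows "\<exists>x. (x, 0) \<in> K \<and> dist x0 x \<le> s0"
proof -
  define below where
    "below k = {k' \<in> K. dist (fst k) (fst k') \<le> snd k - snd k'}" for k :: "'a \<times> real"
  have below_self: "k \<in> below k" if "k \<in> K" for k using that by (simp add: below_def)
  have below_trans: "c \<in> below a" if "b \<in> below a" "c \<in> below b" for a b c
    using that dist_triangle[of "fst a" "fst c" "fst b"] by (auto simp: below_def)
  have bdd: "bdd_below (snd ` below k)" for k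
    by (rule bdd_belowI[of _ 0]) (auto simp: below_def dest: nonneg)
  have ex: "\<exists>k'. k' \<in> below k \<and> snd k' \<le> (snd k + Inf (snd ` below k)) / 2" if kK: "k \<in> K" for k
  proof (cases "Inf (snd ` below k) < snd k")
    case True
    then have "Inf (snd ` below k) < (snd k + Inf (snd ` below k)) / 2" by simp
    then obtain v where "v \<in> snd ` below k" "v < (snd k + Inf (snd ` below k)) / 2"
      using cInf_lessD[of "snd ` below k" "(snd k + Inf (snd ` below k)) / 2"] below_self[OF kK]
      by blast
    then show ?thesis by (metis imageE less_imp_le)
  next
    case False
    then show ?thesis using below_self[OF kK] by (intro exI[of _ k]) simp
  qed
  define nxt where
    "nxt k = (SOME k'. k' \<in> below k \<and> snd k' \<le> (snd k + Inf (snd ` below k)) / 2)" for k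
  have nxt: "nxt k \<in> below k" "snd (nxt k) \<le> (snd k + Inf (snd ` below k)) / 2" if "k \<in> K" for k
    using someI_ex[OF ex[OF that]] by (simp_all add: nxt_def)
  define k where "k n = (nxt ^^ n) (x0, s0)" for n
  have k_Suc: "k (Suc n) = nxt (k n)" for n by (simp add: k_def)
  have kK: "k n \<in> K" for n
  proof (induction n)
    case 0 then show ?case using start by (simp add: k_def)
  next
    case (Suc n) then show ?case using nxt(1)[OF Suc] by (simp add: k_Suc below_def)
  qed
  have chain: "k n \<in> below (k m)" if "m \<le> n" for m n
    using that
  proof (induction n rule: dec_induct)
    case base then show ?case using below_self kK by blast
  next
    case (step n) then show ?case using below_trans nxt(1)[OF kK] by (metis k_Suc)
  qed
  have step: "dist (fst (k m)) (fst (k n)) \<le> snd (k m) - snd (k n)" if "m \<le> n" for m n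
    using chain[OF that] by (simp add: below_def)
  have "decseq (\<lambda>n. snd (k n))"
    unfolding decseq_def using step by (smt (verit) zero_le_dist)
  moreover have "0 \<le> snd (k n)" for n using nonneg[of "fst (k n)"] kK[of n] by simp
  ultimately obtain l where l: "(\<lambda>n. snd (k n)) \<longlonglongrightarrow> l"
    using decseq_convergent[of "\<lambda>n. snd (k n)" 0] by blast
  have "Cauchy (\<lambda>n. fst (k n))"
  proof (rule slope_bounded_Cauchy)
    show "convergent (\<lambda>n. snd (k n))" using l by (auto simp: convergent_def)
  qed (rule step)
  then obtain y where y: "(\<lambda>n. fst (k n)) \<longlonglongrightarrow> y"
    using Cauchy_convergent convergent_def by blast
  have "k \<longlonglongrightarrow> (y, l)" using tendsto_Pair[OF y l] by simp
  then have yl: "(y, l) \<in> K" using K kK by (metis closed_sequentially)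
  have lim_below: "(y, l) \<in> below (k m)" for m
  proof -
    have "dist (fst (k m)) y \<le> snd (k m) - l"
    proof (rule LIMSEQ_le)
      show "(\<lambda>n. dist (fst (k m)) (fst (k n))) \<longlonglongrightarrow> dist (fst (k m)) y"
        by (intro tendsto_intros y)
      show "(\<lambda>n. snd (k m) - snd (k n)) \<longlonglongrightarrow> snd (k m) - l"
        by (intro tendsto_intros l)
      show "\<exists>N. \<forall>n\<ge>N. dist (fst (k m)) (fst (k n)) \<le> snd (k m) - snd (k n)"
        using step by blast
    qed
    then show ?thesis using yl by (simp add: below_def)
  qed
  have "l = 0"
  proof (rule ccontr)
    assume "l \<noteq> 0"
    then have "0 < l" using nonneg[OF yl] by simp
    from descent[OF yl this] obtain x' s' where
      x': "(x', s') \<in> K" "s' < l" "dist y x' \<le> l - s'" by blast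
    then have "(x', s') \<in> below (y, l)" by (simp add: below_def)
    then have "(x', s') \<in> below (k n)" for n using below_trans lim_below by blast
    then have "s' \<in> snd ` below (k n)" for n by (metis image_eqI snd_conv)
    then have "Inf (snd ` below (k n)) \<le> s'" for n by (rule cInf_lower[OF _ bdd])
    then have "snd (k (Suc n)) \<le> (snd (k n) + s') / 2" for n
      using nxt(2)[OF kK[of n]] unfolding k_Suc by (smt (verit) divide_right_mono)
    then have "l \<le> (l + s') / 2"
      by (intro LIMSEQ_le[OF LIMSEQ_Suc[OF l], of "\<lambda>n. (snd (k n) + s') / 2"] tendsto_intros l)
        auto
    with \<open>s' < l\<close> show False by simp
  qed
  then show ?thesis using yl lim_below[of 0] by (auto simp: below_def k_def)
qed

section \<open>Distance to convex sets and cones\<close>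

lemma infdist_greatest:
  assumes "S \<noteq> {}" "\<And>c. c \<in> S \<Longrightarrow> m \<le> dist y c"
  shows "m \<le> infdist y S"
  using assms unfolding infdist_notempty[OF assms(1)] by (intro cINF_greatest) auto

lemma infdist_convex_combination_le:
  fixes C :: "'a::real_normed_vector set"
  assumes "convex C" "c \<in> C" "0 < t" "t \<le> 1"
  shows "infdist (t *\<^sub>R z + (1 - t) *\<^sub>R c) C \<le> t * infdist z C"
proof -
  have "infdist (t *\<^sub>R z + (1 - t) *\<^sub>R c) C / t \<le> infdist z C"
  proof (rule infdist_greatest)
    show "C \<noteq> {}" using assms by auto
    fix w assume w: "w \<in> C"
    have "t *\<^sub>R w + (1 - t) *\<^sub>R c \<in> C"
      using assms w by (intro convexD) auto
    then have "infdist (t *\<^sub>R z + (1 - t) *\<^sub>R c) C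
      \<le> dist (t *\<^sub>R z + (1 - t) *\<^sub>R c) (t *\<^sub>R w + (1 - t) *\<^sub>R c)"
      by (rule infdist_le)
    also have "\<dots> = norm (t *\<^sub>R (z - w))"
      by (simp add: dist_norm algebra_simps)
    also have "\<dots> = t * dist z w" using assms by (simp add: dist_norm)
    finally show "infdist (t *\<^sub>R z + (1 - t) *\<^sub>R c) C / t \<le> dist z w"
      using assms by (simp add: divide_le_eq mult.commute)
  qed
  then show ?thesis using assms by (simp add: divide_le_eq mult.commute)
qed

text \<open>
  Moving away from \<open>C\<close> by \<open>\<rho>\<close> along the ray from \<open>c \<in> C\<close> through \<open>y\<close> multiplies the distance to
  \<open>C\<close> by at least \<open>(n + \<rho>) / n\<close> with \<open>n = dist y c\<close>, by convexity of the distance along the ray.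
  When \<open>c\<close> is an almost nearest point, this factor is almost \<open>(d + \<rho>) / d\<close> with \<open>d\<close> the distance
  of \<open>y\<close>. Nearest points need not exist, so the inequality obtained from \<open>c\<close> is kept for all \<open>c\<close>
  and the infimum is taken at the end.
\<close>

lemma infdist_cball_growth:
  fixes C :: "'a::real_normed_vector set"
  assumes C: "convex C" "C \<noteq> {}" and pos: "0 < infdist y C" and \<rho>: "0 \<le> \<rho>"
    and bound: "\<And>z. dist y z \<le> \<rho> \<Longrightarrow> infdist z C \<le> m"
  shows "infdist y C + \<rho> \<le> m"
proof -
  let ?d = "infdist y C"
  have dm: "?d \<le> m" using bound[of y] \<rho> by simp
  have key: "?d * \<rho> \<le> (m - ?d) * dist y c" if c: "c \<in> C" for c
  proof -
    define n where "n = dist y c"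
    have n: "0 < n" using pos infdist_le[OF c, of y] unfolding n_def by linarith
    define z where "z = y + (\<rho> / n) *\<^sub>R (y - c)"
    define t where "t = n / (n + \<rho>)"
    have t: "0 < t" "t \<le> 1" using n \<rho> by (auto simp: t_def)
    have "1 + \<rho> / n = (n + \<rho>) / n" using n by (simp add: add_divide_distrib)
    then have t1: "t * (1 + \<rho> / n) = 1" using n \<rho> by (simp add: t_def)
    have "t *\<^sub>R z + (1 - t) *\<^sub>R c = (t * (1 + \<rho> / n)) *\<^sub>R y + (1 - t * (1 + \<rho> / n)) *\<^sub>R c"
      by (simp add: z_def algebra_simps)
    then have y: "t *\<^sub>R z + (1 - t) *\<^sub>R c = y" by (simp add: t1)
    have "dist y z = \<rho>" using n \<rho> by (simp add: z_def dist_norm n_def)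
    then have "infdist z C \<le> m" using bound by simp
    then have "?d \<le> t * m"
      using infdist_convex_combination_le[OF C(1) c t, of z] t unfolding y
      by (meson less_imp_le mult_left_mono order_trans)
    then have "?d * (n + \<rho>) \<le> n * m"
      using n \<rho> by (simp add: t_def field_simps)
    then show ?thesis by (simp add: n_def algebra_simps)
  qed
  show ?thesis
  proof (cases "m = ?d")
    case True
    obtain c where "c \<in> C" using C by blast
    from key[OF this] True pos have "\<rho> \<le> 0" by (simp add: mult_le_0_iff)
    then show ?thesis using True by simp
  next
    case False
    then have md: "0 < m - ?d" using dm by simp
    have "?d * \<rho> / (m - ?d) \<le> ?d"
      by (rule infdist_greatest[OF C(2)]) (use key md in \<open>simp add: divide_le_eq mult.commute\<close>)
    then have "\<rho> \<le> m - ?d" using md pos by (simp add: divide_le_eq)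
    then show ?thesis by simp
  qed
qed

text \<open>
  Adding an element of a convex cone does not increase the distance to the cone, so the excess
  of \<open>S + C\<close> over \<open>C\<close> is at most that of \<open>S\<close>.
\<close>

lemma infdist_cone_le_infdist_plus:
  fixes C :: "'a::real_normed_vector set"
  assumes C: "convex_cone C" and S: "S \<noteq> {}" and bound: "\<And>y. y \<in> S \<Longrightarrow> infdist y C \<le> m"
  shows "infdist z C \<le> infdist z (S + C) + m"
proof -
  have ne: "C \<noteq> {}" using C convex_cone_nonempty by blast
  have "infdist z C - m \<le> infdist z (S + C)"
  proof (rule infdist_greatest)
    show "S + C \<noteq> {}" using S ne by (auto simp: set_plus_def)
    fix w assume "w \<in> S + C"
    then obtain y c where w: "w = y + c" "y \<in> S" "c \<in> C" by (auto elim: set_plus_elim)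
    have "infdist w C \<le> infdist y C"
    proof (rule infdist_greatest[OF ne])
      fix c' assume "c' \<in> C"
      then have "c' + c \<in> C" using w C convex_cone_add by blast
      from infdist_le[OF this, of w] show "infdist w C \<le> dist y c'"
        by (simp add: w dist_norm)
    qed
    then have "infdist w C \<le> m" using bound w by fastforce
    moreover have "infdist z C \<le> infdist w C + dist z w" by (rule infdist_triangle)
    ultimately show "infdist z C - m \<le> dist z w" by simp
  qed
  then show ?thesis by simp
qed

section \<open>Error bounds from metric increase\<close>

text \<open>
  For \<open>\<kappa> > 0\<close> the set is the epigraph of the excess of \<open>G\<close> over \<open>C\<close>, with heights divided by
  \<open>\<kappa>\<close>. Its closedness is the lower semicontinuity of the excess: a value of \<open>G\<close> at the limit that is too far
  from \<open>C\<close> would, by lower semicontinuity of \<open>G\<close>, be approximated by values at nearby points that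
  are too far as well.
\<close>

lemma closed_excess_epigraph:
  fixes G :: "'x::metric_space \<Rightarrow> 'y::real_normed_vector set"
  assumes "lsc_map G"
  shows "closed {(x, s). 0 \<le> s \<and> (\<forall>y\<in>G x. infdist y C \<le> \<kappa> * s)}" (is "closed ?K")
proof (unfold closed_sequential_limits, intro allI impI, elim conjE)
  fix k :: "nat \<Rightarrow> 'x \<times> real" and l
  assume kK: "\<forall>n. k n \<in> ?K" and kl: "k \<longlonglongrightarrow> l"
  obtain x s where l: "l = (x, s)" by force
  have x: "(\<lambda>n. fst (k n)) \<longlonglongrightarrow> x" and s: "(\<lambda>n. snd (k n)) \<longlonglongrightarrow> s"
    using tendsto_fst[OF kl] tendsto_snd[OF kl] by (simp_all add: l)
  have k: "0 \<le> snd (k n)" "\<And>y. y \<in> G (fst (k n)) \<Longrightarrow> infdist y C \<le> \<kappa> * snd (k n)" for n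
    using kK[rule_format, of n] by (auto simp: case_prod_beta)
  have "0 \<le> s" using s k(1) by (meson LIMSEQ_le_const)
  moreover have "infdist y C \<le> \<kappa> * s" if y: "y \<in> G x" for y
  proof (rule ccontr)
    assume "\<not> ?thesis"
    then obtain m where m: "\<kappa> * s < m" "m < infdist y C" using dense by (meson not_le)
    let ?U = "{y. m < infdist y C}"
    have "open ?U" by (intro open_Collect_less continuous_intros)
    then have "\<forall>\<^sub>F x' in nhds x. G x' \<inter> ?U \<noteq> {}"
      using assms y m unfolding lsc_map_def by blast
    then have "\<forall>\<^sub>F n in sequentially. G (fst (k n)) \<inter> ?U \<noteq> {}"
      using x by (rule eventually_compose_filterlim)
    moreover have "\<forall>\<^sub>F n in sequentially. \<kappa> * snd (k n) < m"
      using order_tendstoD(2)[OF tendsto_mult_left[OF s] m(1)] .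
    ultimately have "\<forall>\<^sub>F n in sequentially. False"
      by eventually_elim (use k(2) in fastforce)
    then show False by simp
  qed
  ultimately show "l \<in> ?K" by (simp add: l)
qed

text \<open>
  An excess of at most \<open>(\<alpha> - 1) s0\<close> at \<open>x0\<close> can be removed by moving at most \<open>s0\<close>. A small
  step of length \<open>r\<close> gains \<open>(\<alpha> - 1) r\<close>: enlargement by \<open>\<alpha> r\<close> raises the excess of an infeasible value by
  \<open>\<alpha> r\<close>, yet by metric increase the result exceeds the old excess by \<open>r\<close> at most.
\<close>

lemma metric_increase_error_bound:
  fixes G :: "'x::banach \<Rightarrow> 'y::real_normed_vector set"
  assumes C: "closed C" "convex_cone C" and ne: "\<And>x. G x \<noteq> {}" and lsc: "lsc_map G"
    and \<alpha>: "1 < \<alpha>"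
    and inc: "\<And>x. \<not> G x \<subseteq> C \<Longrightarrow> ereal \<alpha> < inc_bound C G x"
    and x0: "\<And>y. y \<in> G x0 \<Longrightarrow> infdist y C \<le> (\<alpha> - 1) * s0" and s0: "0 \<le> s0"
  shows "\<exists>x. G x \<subseteq> C \<and> dist x0 x \<le> s0"
proof -
  let ?K = "{(x, s). 0 \<le> s \<and> (\<forall>y\<in>G x. infdist y C \<le> (\<alpha> - 1) * s)}"
  have Cne: "C \<noteq> {}" and Cconv: "convex C"
    using C(2) by (auto simp: convex_cone_def)
  have in_C: "y \<in> C \<longleftrightarrow> infdist y C = 0" for y
    using in_closed_iff_infdist_zero[OF C(1) Cne] .
  have "\<exists>x. (x, 0) \<in> ?K \<and> dist x0 x \<le> s0"
  proof (rule closed_descent_reaches_zero)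
    show "closed ?K" by (rule closed_excess_epigraph[OF lsc])
    show "(x0, s0) \<in> ?K" using x0 s0 by simp
  next
    fix x s assume xs: "(x, s) \<in> ?K" and s: "0 < s"
    show "\<exists>x' s'. (x', s') \<in> ?K \<and> s' < s \<and> dist x x' \<le> s - s'"
    proof (cases "G x \<subseteq> C")
      case True
      then have "infdist y C = 0" if "y \<in> G x" for y using that in_C by blast
      then show ?thesis using s by (intro exI[of _ x] exI[of _ 0]) simp
    next
      case False
      from inc[OF this] obtain \<beta> \<delta> where \<beta>: "\<alpha> < \<beta>" and \<delta>: "0 < \<delta>" and
        sub: "\<And>r. r \<in> {0<..\<delta>} \<Longrightarrow>
          \<exists>u\<in>cball x r. enlargement (G u) (\<beta> * r) \<subseteq> enlargement (G x + C) r"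
        unfolding inc_bound_def less_Sup_iff by auto
      \<comment> \<open>The cap at \<open>s\<close> keeps the new height \<open>s - r\<close> nonnegative, which is what covers the
        values of \<open>G u\<close> that already lie in \<open>C\<close>.\<close>
      define r where "r = min \<delta> s"
      have r: "0 < r" "r \<le> \<delta>" "r \<le> s" using \<delta> s by (auto simp: r_def)
      obtain u where u: "dist x u \<le> r"
        "enlargement (G u) (\<beta> * r) \<subseteq> enlargement (G x + C) r"
        using sub[of r] r by auto
      have "infdist y C \<le> (\<alpha> - 1) * (s - r)" if y: "y \<in> G u" for y
      proof (cases "y \<in> C")
        case True
        then show ?thesis using in_C \<alpha> r by simp
      next
        case False
        then have pos: "0 < infdist y C" using in_C infdist_nonneg[of y C] by fastforce
        have "infdist y C + \<alpha> * r \<le> r + (\<alpha> - 1) * s"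
        proof (rule infdist_cball_growth[OF Cconv Cne pos])
          show "0 \<le> \<alpha> * r" using \<alpha> r by simp
        next
          fix z assume z: "dist y z \<le> \<alpha> * r"
          also have "\<alpha> * r \<le> \<beta> * r" using \<beta> r by simp
          finally have "infdist z (G u) \<le> \<beta> * r"
            using infdist_le[OF y, of z] by (simp add: dist_commute)
          then have "z \<in> enlargement (G x + C) r"
            using u(2) ne by (auto simp: enlargement_def)
          then have "infdist z (G x + C) \<le> r" by (simp add: enlargement_def)
          moreover have "infdist z C \<le> infdist z (G x + C) + (\<alpha> - 1) * s"
            using xs by (intro infdist_cone_le_infdist_plus[OF C(2) ne]) auto
          ultimately show "infdist z C \<le> r + (\<alpha> - 1) * s" by simp
        qed
        then show ?thesis by (simp add: algebra_simps)
      qed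
      then show ?thesis
        using r u(1) by (intro exI[of _ u] exI[of _ "s - r"]) simp
    qed
  qed auto
  then obtain x where x: "\<And>y. y \<in> G x \<Longrightarrow> infdist y C \<le> 0" "dist x0 x \<le> s0" by auto
  have "G x \<subseteq> C" using x(1) in_C infdist_nonneg by (metis antisym subsetI)
  with x(2) show ?thesis by blast
qed

section \<open>Calmness of convex families\<close>

lemma cone_concave_feasible_convex:
  fixes F :: "'p::real_vector \<times> 'x::real_vector \<Rightarrow> 'y::real_vector set"
  assumes F: "cone_concave C F" and C: "convex_cone C" and t: "0 \<le> t" "t \<le> 1"
    and x: "x \<in> feasible F C p" and y: "y \<in> feasible F C q"
  shows "t *\<^sub>R x + (1 - t) *\<^sub>R y \<in> feasible F C (t *\<^sub>R p + (1 - t) *\<^sub>R q)"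
proof -
  have "F (t *\<^sub>R (p, x) + (1 - t) *\<^sub>R (q, y))
      \<subseteq> (*\<^sub>R) t ` F (p, x) + (*\<^sub>R) (1 - t) ` F (q, y) + C"
    using F t unfolding cone_concave_def by (meson atLeastAtMost_iff)
  also have "\<dots> \<subseteq> C"
  proof
    fix w assume "w \<in> (*\<^sub>R) t ` F (p, x) + (*\<^sub>R) (1 - t) ` F (q, y) + C"
    then obtain a b c where "w = t *\<^sub>R a + (1 - t) *\<^sub>R b + c" "a \<in> C" "b \<in> C" "c \<in> C"
      using x y unfolding feasible_def by (fast elim!: set_plus_elim)
    then show "w \<in> C"
      using C t by (simp add: convex_cone_add convex_cone_scaleR)
  qed
  finally show ?thesis by (simp add: feasible_def)
qed

text \<open>
  The usual argument that a convex function bounded above near a point is Lipschitz from below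
  there, carried out with feasible points instead of the value function, so that infinite values and
  unattained infima do not arise.
\<close>

lemma locally_bounded_value_imp_calm:
  fixes \<phi> :: "'p::real_normed_vector \<times> 'x::real_normed_vector \<Rightarrow> real"
  assumes \<phi>: "convex_on UNIV \<phi>"
    and F: "cone_concave C F" and C: "convex_cone C"
    and xbar: "xbar \<in> Argmin \<phi> F C pbar" and \<delta>: "0 < \<delta>"
    and bound: "\<And>q. q \<in> cball pbar \<delta> \<Longrightarrow> \<exists>y\<in>feasible F C q. \<phi> (q, y) \<le> M"
  shows "calm_problem \<phi> F C pbar xbar"
proof -
  define v where "v = \<phi> (pbar, xbar)"
  define l where "l = (\<bar>M - v\<bar> + 1) / \<delta>"
  have min: "v \<le> \<phi> (pbar, x)" if "x \<in> feasible F C pbar" for x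
  proof -
    have "val \<phi> F C pbar \<le> ereal (\<phi> (pbar, x))"
      unfolding val_def using that by (rule INF_lower)
    moreover have "ereal v = val \<phi> F C pbar"
      using xbar by (simp add: Argmin_def v_def)
    ultimately show ?thesis by (metis ereal_less_eq(3))
  qed
  have "- l \<le> (\<phi> (p, x) - v) / norm (p - pbar)"
    if p: "p \<noteq> pbar" and x: "x \<in> feasible F C p" for p x
  proof -
    define h where "h = norm (p - pbar)"
    have h: "0 < h" using p by (simp add: h_def)
    \<comment> \<open>The point opposite to \<open>p\<close> on the sphere of radius \<open>\<delta>\<close>, and the weight that makes
      \<open>pbar\<close> a convex combination of \<open>p\<close> and \<open>q\<close>.\<close>
    define q where "q = pbar - (\<delta> / h) *\<^sub>R (p - pbar)"
    define t where "t = \<delta> / (\<delta> + h)"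
    have t: "0 \<le> t" "t \<le> 1" and t1: "1 - t = h / (\<delta> + h)"
      using \<delta> h by (auto simp: t_def field_simps)
    have "(1 - t) * (\<delta> / h) = t" using \<delta> h by (simp add: t1) (simp add: t_def)
    moreover have "t *\<^sub>R p + (1 - t) *\<^sub>R q
        = pbar + (t - (1 - t) * (\<delta> / h)) *\<^sub>R (p - pbar)"
      by (simp add: q_def algebra_simps)
    ultimately have comb: "t *\<^sub>R p + (1 - t) *\<^sub>R q = pbar" by simp
    have "q \<in> cball pbar \<delta>" using h \<delta> by (simp add: q_def dist_norm h_def)
    then obtain y where y: "y \<in> feasible F C q" "\<phi> (q, y) \<le> M" using bound by blast
    have "v \<le> \<phi> (t *\<^sub>R (p, x) + (1 - t) *\<^sub>R (q, y))"
      using min cone_concave_feasible_convex[OF F C t x y(1)] by (simp add: comb)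
    also have "\<dots> \<le> t * \<phi> (p, x) + (1 - t) * \<phi> (q, y)"
      using convex_onD[OF \<phi>, of "1 - t" "(p, x)" "(q, y)"] t by simp
    also have "\<dots> \<le> t * \<phi> (p, x) + (1 - t) * M"
      using y t by (simp add: mult_left_mono)
    also have "\<dots> = (\<delta> * \<phi> (p, x) + h * M) / (\<delta> + h)"
      by (simp add: t1) (simp add: t_def add_divide_distrib)
    finally have "v * (\<delta> + h) \<le> \<delta> * \<phi> (p, x) + h * M"
      using \<delta> h by (simp add: le_divide_eq)
    then have "- (h * (M - v)) \<le> \<delta> * (\<phi> (p, x) - v)" by (simp add: algebra_simps)
    moreover have "h * (M - v) \<le> h * (\<bar>M - v\<bar> + 1)" using h by (intro mult_left_mono) auto
    ultimately have "- (h * (\<bar>M - v\<bar> + 1)) \<le> \<delta> * (\<phi> (p, x) - v)" by linarith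
    then have "- l * h \<le> \<phi> (p, x) - v"
      using \<delta> by (simp add: l_def field_simps)
    then show ?thesis using h by (simp add: h_def[symmetric] le_divide_eq)
  qed
  moreover have "0 < l" using \<delta> by (simp add: l_def add_nonneg_pos)
  ultimately show ?thesis
    unfolding calm_problem_def using \<delta>
    by (intro exI[of _ \<delta>] conjI exI[of _ l] INF_greatest) (auto simp: v_def)
qed

theorem corollary4p2:
  fixes \<phi> :: "'p::banach \<times> 'x::banach \<Rightarrow> real"
    and F :: "'p \<times> 'x \<Rightarrow> 'y::banach set"
    and C :: "'y set"
  assumes "closed C" and "convex_cone C" and "{0} \<subset> C" and "C \<subset> UNIV"
    and "\<And>p x. F (p, x) \<noteq> {}" and "\<And>p x. closed (F (p, x))"
    and "qcsvi \<phi> F C"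
    and "dom_val \<phi> F C = UNIV"
  shows "\<forall>pbar. \<forall>xbar \<in> Argmin \<phi> F C pbar. calm_problem \<phi> F C pbar xbar"
proof (intro allI ballI)
  fix pbar xbar assume xbar: "xbar \<in> Argmin \<phi> F C pbar"
  have \<phi>: "convex_on UNIV \<phi>" "continuous_on UNIV \<phi>"
    and lsc: "\<And>p. lsc_map (\<lambda>x. F (p, x))"
    and conc: "cone_concave C F"
    and usc: "\<And>x. Hausdorff_cone_usc C (\<lambda>p. F (p, x))"
    and inc: "1 < alpha_inc C F"
    using assms(7) unfolding qcsvi_def by blast+
  have "ereal 1 < alpha_inc C F" using inc by (simp add: one_ereal_def)
  then obtain \<alpha> where \<alpha>: "1 < \<alpha>" "ereal \<alpha> < alpha_inc C F"
    using ereal_dense2 by (metis less_ereal.simps(1))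
  have incp: "ereal \<alpha> < inc_bound C (\<lambda>u. F (p, u)) x" if "\<not> F (p, x) \<subseteq> C" for p x
  proof -
    have "alpha_inc C F \<le> inc_bound C (\<lambda>u. F (p, u)) x"
      unfolding alpha_inc_def using that by (intro Inf_lower) blast
    with \<alpha>(2) show ?thesis by (rule less_le_trans)
  qed
  have "isCont \<phi> (pbar, xbar)"
    using \<phi>(2) by (simp add: continuous_on_eq_continuous_at)
  then obtain \<eta> where \<eta>: "0 < \<eta>"
    "\<And>z. dist z (pbar, xbar) < \<eta> \<Longrightarrow> dist (\<phi> z) (\<phi> (pbar, xbar)) < 1"
    unfolding continuous_at_eps_delta by (meson zero_less_one)
  \<comment> \<open>Both \<open>q\<close> and the feasible point will be within \<open>s\<close> of \<open>pbar\<close> and \<open>xbar\<close>, so that the pair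
    is at distance at most \<open>2 s < \<eta>\<close>.\<close>
  define s where "s = \<eta> / 3"
  have s: "0 < s" using \<eta> by (simp add: s_def)
  have "0 < (\<alpha> - 1) * s" using \<alpha> s by simp
  then obtain \<delta>0 where \<delta>0: "0 < \<delta>0"
    "\<And>q. q \<in> cball pbar \<delta>0 \<Longrightarrow>
      F (q, xbar) \<subseteq> enlargement (F (pbar, xbar) + C) ((\<alpha> - 1) * s)"
    using usc unfolding Hausdorff_cone_usc_def by meson
  define \<delta> where "\<delta> = min \<delta>0 s"
  have FC: "F (pbar, xbar) \<subseteq> C"
    using xbar by (simp add: Argmin_def feasible_def)
  then have "infdist y C = 0" if "y \<in> F (pbar, xbar)" for y using that by auto
  then have excess: "infdist z C \<le> infdist z (F (pbar, xbar) + C)" for z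
    using infdist_cone_le_infdist_plus[OF assms(2,5), of pbar xbar 0 z] by simp
  show "calm_problem \<phi> F C pbar xbar"
  proof (rule locally_bounded_value_imp_calm[OF \<phi>(1) conc assms(2) xbar])
    show "0 < \<delta>" using \<delta>0 s by (simp add: \<delta>_def)
  next
    fix q assume q: "q \<in> cball pbar \<delta>"
    have near: "infdist y C \<le> (\<alpha> - 1) * s" if "y \<in> F (q, xbar)" for y
    proof -
      have "y \<in> enlargement (F (pbar, xbar) + C) ((\<alpha> - 1) * s)"
        using that \<delta>0(2)[of q] q by (auto simp: \<delta>_def)
      then show ?thesis using excess[of y] by (simp add: enlargement_def)
    qed
    obtain y where y: "F (q, y) \<subseteq> C" "dist xbar y \<le> s"
      using metric_increase_error_bound[OF assms(1,2,5) lsc \<alpha>(1) incp near] s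
      by (meson less_imp_le)
    have "dist (q, y) (pbar, xbar) \<le> dist q pbar + dist y xbar"
      unfolding dist_prod_def by (simp add: sqrt_sum_squares_le_sum)
    also have "\<dots> < \<eta>" using q y(2) \<eta>(1) by (auto simp: \<delta>_def s_def dist_commute)
    finally have "\<phi> (q, y) \<le> \<phi> (pbar, xbar) + 1"
      using \<eta>(2)[of "(q, y)"] by (simp add: dist_real_def)
    then show "\<exists>y\<in>feasible F C q. \<phi> (q, y) \<le> \<phi> (pbar, xbar) + 1"
      using y(1) by (auto simp: feasible_def)
  qed
qed

end
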